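(* Let $p$ be a prime number and let $F$ be an extension field of $\mathbb{Z}_p$ of finite vector space dimension $n \ge 1$. Let $\alpha, \varepsilon \in F\setminus\{0\}$ be such that the polynomial $x^{p}-x-\alpha$ is irreducible in $F[x]$ and the set $\{\varepsilon^{p^{j}} : 0 \le j \le n-1\}$ is a basis for $F$ as an extension field of $\mathbb{Z}_p$. Let $\widehat{F} = F[\beta]/(\beta^{p}-\beta-\alpha)$. Then the following statements hold: 1. for every $c \in F$, the set $\{(\beta^{p-1}-c)^{p^{in}} : 0 \le i \le p-1\}$ is a basis for $\widehat{F}$ as an extension field of $F$; and 2. for every $c \in \mathbb{Z}_p$, the set $\{(\varepsilon(\beta^{p-1}-c))^{p^{l}} : 0 \le l \le np-1\}$ is a basis for $\widehat{F}$ as an extension field of $\mathbb{Z}_p$.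
   Context: $\mathbb{Z}_p$ denotes the prime field of integers modulo $p$. In $\widehat{F} = F[\beta]/(\beta^{p}-\beta-\alpha)$, $\beta$ also denotes the residue class of the indeterminate, so $\beta \in \widehat{F}$ is a root of $x^p-x-\alpha$. "The set is a basis" means that the listed elements are pairwise distinct and form a vector space basis over the indicated field. *)

theory Defs
  imports "HOL-Algebra.Algebra" "HOL-Number_Theory.Residues"
begin

text \<open>
  Vector space notions are those of \<^theory>\<open>HOL-Algebra.Embedded_Algebras\<close>: the field of scalars
  is a subfield \<open>K\<close> of the ambient ring \<open>R\<close>, and linear independence is a property of lists.
\<close>

definition is_basis_over :: "('a, 'm) ring_scheme \<Rightarrow> 'a set \<Rightarrow> 'a list \<Rightarrow> bool"
  where "is_basis_over R K us \<longleftrightarrow>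
    distinct us \<and> set us \<subseteq> carrier R \<and> ring.independent R K us \<and> ring.Span R K us = carrier R"

text \<open>
  \<open>K\<close> is a copy of \<open>\<int>\<^sub>p\<close> inside \<open>F\<close>, so that \<open>F\<close> is an extension field of \<open>\<int>\<^sub>p\<close>.
\<close>

definition is_Zp_subfield :: "nat \<Rightarrow> 'a set \<Rightarrow> ('a, 'm) ring_scheme \<Rightarrow> bool"
  where "is_Zp_subfield p K F \<longleftrightarrow>
    subfield K F \<and> residue_ring (int p) \<simeq> F\<lparr>carrier := K\<rparr>"

definition AS_poly :: "('a, 'm) ring_scheme \<Rightarrow> nat \<Rightarrow> 'a \<Rightarrow> 'a list"
  where "AS_poly F p \<alpha> =
    X\<^bsub>F\<^esub> [^]\<^bsub>poly_ring F\<^esub> p \<ominus>\<^bsub>poly_ring F\<^esub> X\<^bsub>F\<^esub> \<ominus>\<^bsub>poly_ring F\<^esub> ring.poly_of_const F \<alpha>"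

text \<open>The quotient ring \<open>F[x]/(x\<^sup>p - x - \<alpha>)\<close>.\<close>

definition AS_ext :: "('a, 'm) ring_scheme \<Rightarrow> nat \<Rightarrow> 'a \<Rightarrow> 'a list set ring"
  where "AS_ext F p \<alpha> = Rupt\<^bsub>F\<^esub> (carrier F) (AS_poly F p \<alpha>)"

definition AS_embed :: "('a, 'm) ring_scheme \<Rightarrow> nat \<Rightarrow> 'a \<Rightarrow> 'a \<Rightarrow> 'a list set"
  where "AS_embed F p \<alpha> c =
    ring.rupture_surj F (carrier F) (AS_poly F p \<alpha>) (ring.poly_of_const F c)"

definition AS_root :: "('a, 'm) ring_scheme \<Rightarrow> nat \<Rightarrow> 'a \<Rightarrow> 'a list set"
  where "AS_root F p \<alpha> = ring.rupture_surj F (carrier F) (AS_poly F p \<alpha>) X\<^bsub>F\<^esub>"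

end

theory Submission
  imports Defs
begin

text \<open>
  Let \<open>L\<close> be the Artin--Schreier extension, \<open>\<sigma> x = x ^ (p ^ n)\<close> the generator of its Galois group over
  \<open>F\<close>, and \<open>\<Delta> = \<sigma> - 1\<close>. Then \<open>\<sigma> \<beta> = \<beta> + \<tau>\<close> with \<open>0 \<noteq> \<tau> \<in> \<int>\<^sub>p\<close>, so \<open>\<Delta>\<close> lowers the degree in \<open>\<beta>\<close>:
  \<open>\<Delta>\<close> has kernel \<open>F\<close>, \<open>\<Delta> ^ p = 0\<close>, and \<open>\<Delta> ^ (p - 1)\<close> maps \<open>\<epsilon> (\<beta> ^ (p - 1) - c)\<close> to
  \<open>(p - 1)! \<tau> ^ (p - 1) \<epsilon>\<close>. If \<open>W\<close> is a \<open>\<sigma>\<close>-stable additive subgroup with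
  \<open>F \<subseteq> \<Delta> ^ (p - 1) W\<close>, induction along the kernels of \<open>\<Delta> ^ k\<close> gives \<open>W = L\<close>. Both families are
  Frobenius orbits, so this applies to the subspace \<open>W\<close> that they span, and a spanning family
  whose length is the dimension is a basis.
\<close>

section \<open>Finite fields and spans\<close>

text \<open>Without this, \<open>[k] \<cdot> x\<close> also parses as a product of ideals with the list \<open>[k]\<close>.\<close>

no_notation ideal_prod (infixl \<open>\<cdot>\<index>\<close> 80)

section \<open>Binomial theorem and the Frobenius map in characteristic \<open>p\<close>\<close>

lemma (in cring) binomial_expansion:
  assumes "x \<in> carrier R" "y \<in> carrier R"
  shows "(x \<oplus> y) [^] n = (\<Oplus>k\<in>{..n}. [(n choose k)] \<cdot> (x [^] k \<otimes> y [^] (n - k)))"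
proof (induction n)
  case 0
  then show ?case using assms by simp
next
  case (Suc n)
  let ?f = "\<lambda>k. [(n choose k)] \<cdot> (x [^] k \<otimes> y [^] (Suc n - k))"
  let ?g = "\<lambda>k. [(n choose k)] \<cdot> (x [^] Suc k \<otimes> y [^] (n - k))"
  have fg: "?f \<in> A \<rightarrow> carrier R" "?g \<in> A \<rightarrow> carrier R" for A
    using assms by auto
  have x: "x \<otimes> (x \<oplus> y) [^] n = (\<Oplus>k\<in>{..n}. ?g k)"
    unfolding Suc using assms
    by (subst finsum_rdistr) (auto intro!: finsum_cong' simp: add_pow_rdistr m_ac)
  have "y \<otimes> (x \<oplus> y) [^] n = (\<Oplus>k\<in>{..n}. ?f k)"
    unfolding Suc using assms
    by (subst finsum_rdistr) (auto intro!: finsum_cong' simp: add_pow_rdistr m_ac Suc_diff_le)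
  \<comment> \<open>Extending the range is free because \<open>n choose Suc n\<close> is 0;
    splitting off the term at 0 then aligns both sums for Pascal's rule.\<close>
  also have "\<dots> = (\<Oplus>k\<in>{..Suc n}. ?f k)"
    using assms fg by (subst finsum_Suc) (auto simp: binomial_eq_0)
  also have "\<dots> = (\<Oplus>k\<in>{..n}. ?f (Suc k)) \<oplus> ?f 0"
    using fg by (subst finsum_Suc2) auto
  finally have y: "y \<otimes> (x \<oplus> y) [^] n = (\<Oplus>k\<in>{..n}. ?f (Suc k)) \<oplus> ?f 0" .
  have "(x \<oplus> y) [^] Suc n = x \<otimes> (x \<oplus> y) [^] n \<oplus> y \<otimes> (x \<oplus> y) [^] n"
    using assms by (simp add: l_distr m_comm)
  also have "\<dots> = ((\<Oplus>k\<in>{..n}. ?g k) \<oplus> (\<Oplus>k\<in>{..n}. ?f (Suc k))) \<oplus> ?f 0"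
    unfolding x y using assms by (simp add: a_assoc)
  also have "(\<Oplus>k\<in>{..n}. ?g k) \<oplus> (\<Oplus>k\<in>{..n}. ?f (Suc k)) = (\<Oplus>k\<in>{..n}. ?g k \<oplus> ?f (Suc k))"
    using assms by (subst finsum_addf) auto
  also have "\<dots> = (\<Oplus>k\<in>{..n}. [(Suc n choose Suc k)] \<cdot> (x [^] Suc k \<otimes> y [^] (Suc n - Suc k)))"
    using assms by (intro finsum_cong') (auto simp: add.nat_pow_mult)
  also have "\<dots> \<oplus> ?f 0 = (\<Oplus>k\<in>{..Suc n}. [(Suc n choose k)] \<cdot> (x [^] k \<otimes> y [^] (Suc n - k)))"
    using assms by (subst finsum_Suc2) auto
  finally show ?case .
qed

lemma (in ring) add_pow_eq_zero:
  fixes p m :: nat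
  assumes "[p] \<cdot> \<one> = \<zero>" "p dvd m" "x \<in> carrier R"
  shows "[m] \<cdot> x = \<zero>"
proof -
  obtain k where m: "m = k * p" using assms(2) by (auto simp: dvd_def mult.commute)
  have "[p] \<cdot> x = ([p] \<cdot> \<one>) \<otimes> x"
    using assms(3) by (simp add: add_pow_ldistr)
  then have "[p] \<cdot> x = \<zero>"
    using assms by simp
  then show ?thesis
    unfolding m using assms(3) add.nat_pow_pow[of x k p] by (simp add: mult.commute)
qed

text \<open>The prime \<open>p\<close> divides every inner binomial coefficient, so only the two
  extreme terms of the expansion survive.\<close>

lemma (in cring) frobenius_add:
  fixes p :: nat
  assumes "Factorial_Ring.prime p" "[p] \<cdot> \<one> = \<zero>" "x \<in> carrier R" "y \<in> carrier R"
  shows "(x \<oplus> y) [^] p = x [^] p \<oplus> y [^] p"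
proof -
  obtain r where p: "p = Suc (Suc r)"
    using prime_ge_2_nat[OF assms(1)] by (metis add_2_eq_Suc le_Suc_ex)
  let ?f = "\<lambda>k. [(p choose k)] \<cdot> (x [^] k \<otimes> y [^] (p - k))"
  have mid: "?f k = \<zero>" if "0 < k" "k < p" for k
    using add_pow_eq_zero[OF assms(2)] dvd_choose_prime[of k p] assms that by auto
  have f: "?f \<in> A \<rightarrow> carrier R" for A
    using assms by auto
  have "(x \<oplus> y) [^] p = (\<Oplus>k\<in>{..Suc (Suc r)}. ?f k)"
    using binomial_expansion[OF assms(3,4), of p] p by simp
  also have "\<dots> = ?f p \<oplus> (\<Oplus>k\<in>{..Suc r}. ?f k)"
    using finsum_Suc[OF f, of "Suc r"] p by simp
  also have "(\<Oplus>k\<in>{..Suc r}. ?f k) = (\<Oplus>k\<in>{..r}. ?f (Suc k)) \<oplus> ?f 0"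
    by (rule finsum_Suc2[OF f])
  also have "(\<Oplus>k\<in>{..r}. ?f (Suc k)) = \<zero>"
    by (intro add.finprod_one_eqI mid) (auto simp: p)
  finally show ?thesis
    using assms by simp
qed

lemma (in cring) frobenius_hom:
  fixes p :: nat
  assumes "Factorial_Ring.prime p" "[p] \<cdot> \<one> = \<zero>"
  shows "(\<lambda>x. x [^] (p ^ m)) \<in> ring_hom R R"
proof (induction m)
  case 0
  then show ?case by (auto simp: ring_hom_def simp del: One_nat_def)
next
  case (Suc m)
  then have "x \<in> carrier R \<Longrightarrow> y \<in> carrier R \<Longrightarrow>
      (x \<oplus> y) [^] (p ^ m) = x [^] (p ^ m) \<oplus> y [^] (p ^ m)" for x y
    by (auto simp: ring_hom_def)
  then show ?case
    using frobenius_add[OF assms]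
    by (auto simp: ring_hom_def nat_pow_distrib simp flip: nat_pow_pow simp: mult.commute[of p])
qed

section \<open>Finite subfields, dimension and spanning lists\<close>

lemma (in ring) card_dimension:
  assumes "subfield K R" "finite K" "dimension n K E"
  shows "finite E \<and> card E = card K ^ n"
  using assms(3,1,2)
proof (induction rule: dimension.induct)
  case (zero_dim K)
  then show ?case by simp
next
  case (Suc_dim v E n K)
  note E = space_subgroup_props[OF Suc_dim.prems(1) Suc_dim.hyps(3)]
  have K: "subring K R" using Suc_dim.prems(1) subfieldE(1) by blast
  note Kp = subringE[OF K]
  \<comment> \<open>A vector \<open>v\<close> outside \<open>E\<close> enlarges the space to all
    \<open>k \<otimes> v \<oplus> u\<close>; uniqueness of \<open>k\<close> and \<open>u\<close>
    multiplies the cardinality by that of \<open>K\<close>.\<close>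
  have inj: "inj_on (\<lambda>(k, u). k \<otimes> v \<oplus> u) (K \<times> E)"
  proof (intro inj_onI, clarify)
    fix k u k' u'
    assume *: "k \<in> K" "u \<in> E" "k' \<in> K" "u' \<in> E" "k \<otimes> v \<oplus> u = k' \<otimes> v \<oplus> u'"
    have c: "k \<in> carrier R" "k' \<in> carrier R" "u \<in> carrier R" "u' \<in> carrier R"
      using * E(1) Kp(1) by auto
    have "(k \<ominus> k') \<otimes> v = (k \<otimes> v \<oplus> u) \<ominus> (k' \<otimes> v \<oplus> u) "
      using c Suc_dim.hyps(1) by algebra
    also have "\<dots> = u' \<ominus> u"
      unfolding *(5) using c Suc_dim.hyps(1) by algebra
    finally have eq: "(k \<ominus> k') \<otimes> v = u' \<ominus> u" .
    moreover have "u' \<ominus> u \<in> E"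
      using * E by (simp add: minus_eq)
    \<comment> \<open>A nonzero scalar could be divided out, which would put \<open>v\<close> into
      \<open>E\<close>.\<close>
    ultimately have "k \<ominus> k' = \<zero>"
      using E(6)[of "k \<ominus> k'" v] Suc_dim.hyps(1,2) * Kp by (auto simp: minus_eq)
    then have "k = k'"
      using c by simp
    then show "k = k' \<and> u = u'"
      using *(5) c Suc_dim.hyps(1) add.l_cancel[of "k \<otimes> v" u u'] by simp
  qed
  have eq: "line_extension K v E = (\<lambda>(k, u). k \<otimes> v \<oplus> u) ` (K \<times> E)"
    by (auto simp: line_extension_mem_iff image_def) blast
  show ?case
    using Suc_dim.IH[OF Suc_dim.prems] Suc_dim.prems(2)
    by (simp add: eq card_image[OF inj] card_cartesian_product)
qed

text \<open>Lagrange's theorem in the multiplicative group of \<open>K\<close> handles the nonzero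
  elements.\<close>

lemma (in field) pow_card_subfield:
  assumes "subfield K R" "finite K" "x \<in> K"
  shows "x [^] card K = x"
proof (cases "x = \<zero>")
  case True
  have "card K \<noteq> 0"
    using assms by auto
  then show ?thesis using True by (simp add: nat_pow_zero)
next
  case False
  have *: "x [^]\<^bsub>M\<^esub> (n :: nat) = x [^] n" if "M = Multiplicative_Group.mult_of (R\<lparr>carrier := K\<rparr>)" for n M
    using that by (induction n) (simp_all add: nat_pow_def)
  note pow = *[OF refl]
  interpret K: field "R\<lparr>carrier := K\<rparr>" using subfield_iff(2)[OF assms(1)] .
  have "x [^] (card K - 1) = \<one>"
    using group.pow_order_eq_1[OF K.field_mult_group, of x] assms False
    by (simp add: order_def pow)
  moreover have "card K = Suc (card K - 1)"
    using assms by (metis Suc_diff_1 card_gt_0_iff empty_iff)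
  moreover have "x \<in> carrier R"
    using assms subfieldE(3) by blast
  ultimately show ?thesis
    by (metis nat_pow_Suc l_one)
qed

text \<open>The nonzero elements of \<open>K\<close> are \<open>card K - 1\<close> solutions of
  \<open>x [^] (card K - 1) = \<one>\<close>, and a field has no more than that many. Subfields thus
  become fixed-point sets of power maps.\<close>

lemma (in field) pow_card_subfield_iff:
  assumes "subfield K R" "finite (carrier R)" "x \<in> carrier R"
  shows "x [^] card K = x \<longleftrightarrow> x \<in> K"
proof
  note K = subfieldE[OF assms(1)] subringE[OF subfieldE(1)[OF assms(1)]]
  have fin: "finite K" using K(3) assms(2) finite_subset by blast
  have "card {\<zero>, \<one>} \<le> card K"
    using K fin by (intro card_mono) auto
  then have card: "card K = Suc (card K - 1)" "card K - 1 \<noteq> 0"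
    by auto
  let ?U = "{x \<in> carrier R. x [^] (card K - 1) = \<one>}"
  have cancel: "y [^] (card K - 1) = \<one>" if "y \<in> carrier R" "y [^] card K = y" "y \<noteq> \<zero>" for y
  proof -
    have "y \<otimes> y [^] (card K - 1) = y \<otimes> \<one>"
      using that card(1) by (metis nat_pow_Suc m_comm nat_pow_closed r_one)
    then show ?thesis
      using that m_lcancel[of y "y [^] (card K - 1)" \<one>] by simp
  qed
  have "K - {\<zero>} \<subseteq> ?U"
    using cancel pow_card_subfield[OF assms(1) fin] K(3) by auto
  moreover have "card ?U \<le> card (K - {\<zero>})"
    using num_roots_le_deg[OF assms(2) card(2)] fin K(8) by (simp add: card_Diff_singleton)
  ultimately have "K - {\<zero>} = ?U"
    using assms(2) by (intro card_seteq) auto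
  then show "x \<in> K" if "x [^] card K = x"
    using cancel[OF assms(3) that] assms(3) K(8) by blast
  show "x [^] card K = x" if "x \<in> K"
    using pow_card_subfield[OF assms(1) fin that] .
qed

text \<open>Lagrange's theorem in the additive group of \<open>K\<close>, applied to the
  unit.\<close>

lemma (in ring) char_card_subfield:
  assumes "subfield K R"
  shows "[card K] \<cdot> \<one> = \<zero>"
proof -
  have K: "subgroup K (add_monoid R)"
    using subring.axioms(1)[OF subfieldE(1)[OF assms]] .
  interpret K: group "(add_monoid R)\<lparr>carrier := K\<rparr>"
    using add.subgroup_imp_group[OF K] .
  have "\<one> \<in> K" using subringE(3)[OF subfieldE(1)[OF assms]] .
  then have "\<one> [^]\<^bsub>(add_monoid R)\<lparr>carrier := K\<rparr>\<^esub> card K = \<zero>"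
    using K.pow_order_eq_1[of \<one>] by (simp add: order_def)
  then show ?thesis
    by (simp add: add_pow_def nat_pow_def)
qed

text \<open>By Bezout some multiple of \<open>k\<close> exceeds a multiple of \<open>p\<close> by 1,
  so if both killed the unit it would be zero.\<close>

lemma (in ring) add_pow_neq_zero:
  fixes p :: nat
  assumes "Factorial_Ring.prime p" "[p] \<cdot> \<one> = \<zero>" "\<one> \<noteq> \<zero>" "0 < k" "k < p"
  shows "[k] \<cdot> \<one> \<noteq> \<zero>"
proof
  assume k: "[k] \<cdot> \<one> = \<zero>"
  have "coprime k p"
    using assms by (meson coprime_commute nat_dvd_not_less prime_imp_coprime)
  then obtain u v where "u * k = v * p + 1"
    using bezout_nat[of k p] assms(4) by auto (metis coprime_imp_gcd_eq_1 mult.commute)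
  then have "\<zero> \<oplus> \<one> = \<zero>"
    using add_pow_eq_zero[OF k, of "u * k" \<one>] add_pow_eq_zero[OF assms(2), of "v * p" \<one>]
    by (metis add.nat_pow_Suc Suc_eq_plus1 dvd_triv_right one_closed)
  then show False using assms(3) by simp
qed

text \<open>Each vector raises the dimension of the span by at most one. If length and dimension
  agree, each one raises it, so none lies in the span of the later ones.\<close>

lemma (in ring) length_ge_dimension:
  assumes K: "subfield K R" and Us: "set Us \<subseteq> carrier R" and "dimension m K (Span K Us)"
  shows "m \<le> length Us \<and> (length Us = m \<longrightarrow> independent K Us)"
  using Us assms(3)
proof (induction Us arbitrary: m)
  case Nil
  then show ?case
    using dimension_is_inj[OF K] dimension.zero_dim by auto
next
  case (Cons u Us)
  obtain l where l: "dimension l K (Span K Us)"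
    using filter_base[OF K, of Us] dimension_independent Cons.prems by (metis insert_subset list.set(2))
  note IH = Cons.IH[OF _ l]
  show ?case
  proof (cases "u \<in> Span K Us")
    case True
    \<comment> \<open>Here \<open>m\<close> is at most the length of the tail, so the clause on
      equality holds vacuously.\<close>
    then have "Span K (u # Us) = Span K Us"
      using Span_base_incl[OF K] mono_Span_subset[OF K] Cons.prems(1)
      by (metis insert_subset list.simps(15) subset_antisym)
    then have "m = l"
      using dimension_is_inj[OF K] l Cons.prems by metis
    then show ?thesis
      using IH Cons.prems by auto
  next
    case False
    then have "dimension (Suc l) K (Span K (u # Us))"
      using Suc_dim[OF _ False l] Cons.prems by simp
    then have "m = Suc l"
      using dimension_is_inj[OF K] Cons.prems by metis
    then show ?thesis
      using IH Cons.prems False li_Cons by auto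
  qed
qed

lemma (in ring) spanning_is_basis_over:
  assumes "subfield K R" "set Us \<subseteq> carrier R" "dimension (length Us) K (carrier R)"
    "carrier R \<subseteq> Span K Us"
  shows "is_basis_over R K Us"
proof -
  have "Span K Us = carrier R"
    using assms(4) Span_subgroup_props(1)[OF assms(1,2)] by blast
  moreover from this have "independent K Us"
    using length_ge_dimension[OF assms(1,2)] assms(3) by auto
  ultimately show ?thesis
    unfolding is_basis_over_def using assms(2) independent_distinct[OF assms(1)] by blast
qed

text \<open>Since \<open>E\<close> need only be an additive subgroup, this applies directly to
  preimages under power maps and images under \<open>\<Delta> ^^ m\<close>, with only multiples of
  generators to check.\<close>

lemma (in ring) Span_subsetI:
  assumes "subfield K R" "set Us \<subseteq> carrier R" "subgroup E (add_monoid R)"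
    and "\<And>k u. k \<in> K \<Longrightarrow> u \<in> set Us \<Longrightarrow> k \<otimes> u \<in> E"
  shows "Span K Us \<subseteq> E"
  using assms(4) by (intro Span_min[OF assms(1-3)]) (auto simp: set_mult_def)

lemma (in ring) subring_nat_pow_closed:
  assumes "subring K R" "x \<in> K"
  shows "x [^] (m :: nat) \<in> K"
  using subringE(3,6)[OF assms(1)] assms(2) by (induction m) auto

lemma (in ring) subring_add_pow_closed:
  assumes "subring K R" "x \<in> K"
  shows "[(m :: nat)] \<cdot> x \<in> K"
  using subringE(2,7)[OF assms(1)] assms(2) by (induction m) auto

lemma (in monoid) nat_pow_iterate_fixed:
  fixes q m :: nat
  assumes "x \<in> carrier G" "x [^] q = x"
  shows "x [^] (q ^ m) = x"
proof (induction m)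
  case 0
  then show ?case using assms(1) by (simp del: One_nat_def)
next
  case (Suc m)
  have "x [^] (q ^ Suc m) = (x [^] q) [^] (q ^ m)"
    using assms(1) by (simp add: nat_pow_pow)
  then show ?case using Suc assms(2) by simp
qed

section \<open>Unipotent translations\<close>

text \<open>Abstracts a generator \<open>\<sigma>\<close> of the Galois group with fixed field
  \<open>F\<close>, moving the generator \<open>b\<close> of the extension by a constant.\<close>

locale unipotent_shift = field L for L (structure) +
  fixes F :: "'a set" and \<sigma> :: "'a \<Rightarrow> 'a" and b \<tau> :: 'a
  assumes subfield_F: "subfield F L"
    and \<sigma>_hom: "\<sigma> \<in> ring_hom L L"
    and \<sigma>_fixed: "x \<in> carrier L \<Longrightarrow> \<sigma> x = x \<longleftrightarrow> x \<in> F"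
    and b_closed: "b \<in> carrier L"
    and \<sigma>_b: "\<sigma> b = b \<oplus> \<tau>"
    and \<tau>_in: "\<tau> \<in> F"
begin

definition \<Delta> :: "'a \<Rightarrow> 'a" where "\<Delta> x = \<sigma> x \<ominus> x"

lemma F_carrier: "x \<in> F \<Longrightarrow> x \<in> carrier L"
  using subfieldE(3)[OF subfield_F] by blast

lemmas \<sigma>_closed [simp] = ring_hom_closed[OF \<sigma>_hom]
lemmas \<sigma>_add = ring_hom_add[OF \<sigma>_hom]
lemmas \<sigma>_mult = ring_hom_mult[OF \<sigma>_hom]

lemma \<Delta>_closed [simp]: "x \<in> carrier L \<Longrightarrow> \<Delta> x \<in> carrier L"
  by (simp add: \<Delta>_def)

lemma \<Delta>_pow_closed [simp]: "x \<in> carrier L \<Longrightarrow> (\<Delta> ^^ k) x \<in> carrier L"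
  by (induction k) auto

lemma \<Delta>_add: "x \<in> carrier L \<Longrightarrow> y \<in> carrier L \<Longrightarrow> \<Delta> (x \<oplus> y) = \<Delta> x \<oplus> \<Delta> y"
  using \<sigma>_closed[of x] \<sigma>_closed[of y] unfolding \<Delta>_def \<sigma>_add by algebra

lemma \<Delta>_smult: "c \<in> F \<Longrightarrow> x \<in> carrier L \<Longrightarrow> \<Delta> (c \<otimes> x) = c \<otimes> \<Delta> x"
  using \<sigma>_closed[of x] F_carrier[of c] \<sigma>_fixed[of c]
  unfolding \<Delta>_def by (auto simp: \<sigma>_mult r_minus r_distr minus_eq)

lemma \<Delta>_pow_add:
  "x \<in> carrier L \<Longrightarrow> y \<in> carrier L \<Longrightarrow> (\<Delta> ^^ k) (x \<oplus> y) = (\<Delta> ^^ k) x \<oplus> (\<Delta> ^^ k) y"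
  by (induction k) (auto simp: \<Delta>_add)

lemma \<Delta>_pow_smult:
  "c \<in> F \<Longrightarrow> x \<in> carrier L \<Longrightarrow> (\<Delta> ^^ k) (c \<otimes> x) = c \<otimes> (\<Delta> ^^ k) x"
  by (induction k) (auto simp: \<Delta>_smult)

lemma \<Delta>_pow_zero [simp]: "(\<Delta> ^^ k) \<zero> = \<zero>"
  using \<Delta>_pow_smult[of \<zero> \<zero> k] subringE(2)[OF subfieldE(1)[OF subfield_F]] by simp

lemma \<Delta>_pow_minus:
  assumes "x \<in> carrier L" "y \<in> carrier L"
  shows "(\<Delta> ^^ k) (x \<ominus> y) = (\<Delta> ^^ k) x \<ominus> (\<Delta> ^^ k) y"
proof -
  have "(\<Delta> ^^ k) x = (\<Delta> ^^ k) ((x \<ominus> y) \<oplus> y)"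
    using assms by (simp add: minus_eq a_assoc l_neg)
  also have "\<dots> = (\<Delta> ^^ k) (x \<ominus> y) \<oplus> (\<Delta> ^^ k) y"
    using assms by (intro \<Delta>_pow_add) auto
  finally show ?thesis
    using assms by (simp add: minus_eq a_assoc r_neg)
qed

lemma \<Delta>_eq_zero_iff: "x \<in> carrier L \<Longrightarrow> \<Delta> x = \<zero> \<longleftrightarrow> x \<in> F"
  using \<sigma>_fixed[of x] by (simp add: \<Delta>_def)

text \<open>Twisted Leibniz rule, from expanding
  \<open>(x \<oplus> \<Delta> x) \<otimes> (b \<oplus> \<tau>)\<close>.\<close>

lemma \<Delta>_mult_b:
  assumes "x \<in> carrier L"
  shows "\<Delta> (x \<otimes> b) = \<Delta> x \<otimes> b \<oplus> (\<tau> \<otimes> \<Delta> x \<oplus> \<tau> \<otimes> x)"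
  using assms \<sigma>_closed[of x] b_closed F_carrier[OF \<tau>_in]
  unfolding \<Delta>_def \<sigma>_mult[OF assms b_closed] \<sigma>_b by algebra

text \<open>Each application of the Leibniz rule leaves one more term
  \<open>\<tau> \<otimes> x\<close>, while terms with too many \<open>\<Delta>\<close> vanish. The
  induction passes from \<open>x\<close> to \<open>\<Delta> x\<close>, which is killed one step
  earlier.\<close>

lemma \<Delta>_pow_mult_b:
  assumes "x \<in> carrier L" "(\<Delta> ^^ Suc k) x = \<zero>"
  shows "(\<Delta> ^^ Suc k) (x \<otimes> b) = ([Suc k] \<cdot> \<tau>) \<otimes> (\<Delta> ^^ k) x"
  using assms
proof (induction k arbitrary: x)
  case 0
  then show ?case
    using F_carrier[OF \<tau>_in] b_closed by (simp add: \<Delta>_mult_b)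
next
  case (Suc k)
  note \<tau> = F_carrier[OF \<tau>_in]
  have shift: "(\<Delta> ^^ m) (\<Delta> x) = (\<Delta> ^^ Suc m) x" for m
    by (simp only: funpow_Suc_right o_apply)
  have "(\<Delta> ^^ Suc (Suc k)) (x \<otimes> b) = (\<Delta> ^^ Suc k) (\<Delta> x \<otimes> b \<oplus> (\<tau> \<otimes> \<Delta> x \<oplus> \<tau> \<otimes> x))"
    using Suc.prems by (subst funpow_Suc_right) (simp add: \<Delta>_mult_b)
  also have "\<dots> = (\<Delta> ^^ Suc k) (\<Delta> x \<otimes> b) \<oplus> (\<tau> \<otimes> (\<Delta> ^^ Suc k) (\<Delta> x) \<oplus> \<tau> \<otimes> (\<Delta> ^^ Suc k) x)"
    using Suc.prems(1) \<tau> b_closed \<tau>_in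
    by (simp only: \<Delta>_pow_add \<Delta>_pow_smult \<Delta>_closed m_closed a_closed)
  also have "(\<Delta> ^^ Suc k) (\<Delta> x) = \<zero>"
    using Suc.prems(2) shift by simp
  also have "(\<Delta> ^^ Suc k) (\<Delta> x \<otimes> b) = ([Suc k] \<cdot> \<tau>) \<otimes> (\<Delta> ^^ Suc k) x"
    using Suc.IH[of "\<Delta> x"] Suc.prems shift by simp
  also have "([Suc k] \<cdot> \<tau>) \<otimes> (\<Delta> ^^ Suc k) x \<oplus> (\<tau> \<otimes> \<zero> \<oplus> \<tau> \<otimes> (\<Delta> ^^ Suc k) x)
      = ([Suc (Suc k)] \<cdot> \<tau>) \<otimes> (\<Delta> ^^ Suc k) x"
    using \<tau> Suc.prems(1) \<Delta>_pow_closed[of x "Suc k"]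
    by (simp add: l_distr del: funpow.simps)
  finally show ?case .
qed

text \<open>Powers of \<open>b\<close> behave like polynomials of that degree under differences: the
  coefficient \<open>[Suc k] \<cdot> \<tau>\<close> lies in \<open>F\<close>, so
  \<open>\<Delta>\<close> passes through it to the previous power.\<close>

lemma \<Delta>_pow_Suc_b_pow: "(\<Delta> ^^ Suc k) (b [^] k) = \<zero>"
proof (induction k)
  case 0
  have "\<one> \<in> F" using subringE(3)[OF subfieldE(1)[OF subfield_F]] .
  then show ?case using \<Delta>_eq_zero_iff[of \<one>] by simp
next
  case (Suc k)
  have "(\<Delta> ^^ Suc (Suc k)) (b [^] Suc k) = \<Delta> ((\<Delta> ^^ Suc k) (b [^] k \<otimes> b))"
    by simp
  also have "\<dots> = \<Delta> (([Suc k] \<cdot> \<tau>) \<otimes> (\<Delta> ^^ k) (b [^] k))"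
    using \<Delta>_pow_mult_b[OF _ Suc] b_closed by simp
  also have "\<dots> = ([Suc k] \<cdot> \<tau>) \<otimes> (\<Delta> ^^ Suc k) (b [^] k)"
  proof -
    have "[m] \<cdot> \<tau> \<in> F" for m :: nat
      using \<tau>_in subringE[OF subfieldE(1)[OF subfield_F]] by (induction m) auto
    from \<Delta>_smult[OF this, of "(\<Delta> ^^ k) (b [^] k)" "Suc k"] show ?thesis
      using b_closed by simp
  qed
  finally show ?case
    using Suc F_carrier[OF \<tau>_in] by simp
qed

text \<open>Difference analogue of the \<open>k\<close>-th derivative of the \<open>k\<close>-th
  power.\<close>

lemma \<Delta>_pow_b_pow: "(\<Delta> ^^ k) (b [^] k) = [(fact k :: nat)] \<cdot> (\<tau> [^] k)"
proof (induction k)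
  case (Suc k)
  have "(\<Delta> ^^ Suc k) (b [^] Suc k) = ([Suc k] \<cdot> \<tau>) \<otimes> ([(fact k :: nat)] \<cdot> (\<tau> [^] k))"
    using \<Delta>_pow_mult_b[OF _ \<Delta>_pow_Suc_b_pow] b_closed Suc by simp
  also have "\<dots> = [(fact k :: nat)] \<cdot> ([(Suc k)] \<cdot> (\<tau> \<otimes> \<tau> [^] k))"
    using F_carrier[OF \<tau>_in] by (simp only: add_pow_ldistr add_pow_rdistr nat_pow_closed add.nat_pow_closed)
  also have "\<dots> = [(fact (Suc k) :: nat)] \<cdot> (\<tau> [^] Suc k)"
    using F_carrier[OF \<tau>_in] by (subst add.nat_pow_pow) (simp_all add: m_comm mult.commute)
  finally show ?case .
qed simp

text \<open>The list \<open>exp_base b m\<close> holds the powers of \<open>b\<close> below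
  \<open>m\<close>; for a spanning list this makes \<open>\<Delta>\<close> nilpotent.\<close>

lemma \<Delta>_pow_eq_zero_of_Span:
  assumes "x \<in> Span F (exp_base b m)"
  shows "(\<Delta> ^^ m) x = \<zero>"
  using assms
proof (induction m arbitrary: x)
  case 0
  then show ?case by (simp add: exp_base_def)
next
  case (Suc m)
  then obtain k v where x: "k \<in> F" "v \<in> Span F (exp_base b m)" "x = k \<otimes> b [^] m \<oplus> v"
    by (auto simp: exp_base_def line_extension_mem_iff)
  have v: "v \<in> carrier L"
    using Span_subgroup_props(1)[OF subfield_F exp_base_closed[OF b_closed]] x(2) by blast
  have "(\<Delta> ^^ Suc m) x = k \<otimes> (\<Delta> ^^ Suc m) (b [^] m) \<oplus> \<Delta> ((\<Delta> ^^ m) v)"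
    using x v b_closed F_carrier by (simp add: \<Delta>_pow_add \<Delta>_pow_smult \<Delta>_add \<Delta>_smult)
  also have "\<Delta> ((\<Delta> ^^ m) v) = \<zero>"
    using Suc.IH[OF x(2)] \<Delta>_pow_zero[of 1] by simp
  also have "k \<otimes> (\<Delta> ^^ Suc m) (b [^] m) \<oplus> \<zero> = \<zero>"
    using \<Delta>_pow_Suc_b_pow x(1) F_carrier by (simp del: funpow.simps)
  finally show ?case .
qed

lemma \<sigma>_stable_subgroup_eq_carrier:
  assumes W: "subgroup W (add_monoid L)" "\<And>x. x \<in> W \<Longrightarrow> \<sigma> x \<in> W"
    and F: "F \<subseteq> (\<Delta> ^^ m) ` W"
    and nilp: "\<And>x. x \<in> carrier L \<Longrightarrow> (\<Delta> ^^ Suc m) x = \<zero>"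
  shows "carrier L \<subseteq> W"
proof -
  note Wp = add.subgroupE[OF W(1)]
  have W_minus: "x \<ominus> y \<in> W" if "x \<in> W" "y \<in> W" for x y
    using that Wp(3,4) by (simp add: minus_eq)
  have W_\<Delta>: "(\<Delta> ^^ k) x \<in> W" if "x \<in> W" for k x
    using that by (induction k) (auto simp: \<Delta>_def W(2) intro: W_minus)
  \<comment> \<open>The bound on \<open>k\<close> ensures that \<open>m - k\<close> is a genuine
    difference in the step below.\<close>
  have "x \<in> W" if "k \<le> Suc m" "x \<in> carrier L" "(\<Delta> ^^ k) x = \<zero>" for k x
    using that
  proof (induction k arbitrary: x)
    case 0
    then show ?case using subgroup.one_closed[OF W(1)] by simp
  next
    case (Suc k)
    have "(\<Delta> ^^ k) x \<in> F"
      using Suc.prems \<Delta>_eq_zero_iff[of "(\<Delta> ^^ k) x"] by simp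
    then obtain v where v: "v \<in> W" "(\<Delta> ^^ k) x = (\<Delta> ^^ m) v"
      using F by blast
    \<comment> \<open>An element of \<open>W\<close> with the same image as \<open>x\<close> under
      \<open>\<Delta> ^^ k\<close>; subtracting it moves \<open>x\<close> one kernel down.\<close>
    define u where "u = (\<Delta> ^^ (m - k)) v"
    have u: "u \<in> W" "u \<in> carrier L"
      using W_\<Delta> v(1) Wp(1) by (auto simp: u_def)
    have "(\<Delta> ^^ k) u = (\<Delta> ^^ m) v"
      using Suc.prems(1) funpow_add[of k "m - k" \<Delta>] by (simp add: u_def)
    then have "(\<Delta> ^^ k) (x \<ominus> u) = (\<Delta> ^^ m) v \<ominus> (\<Delta> ^^ m) v"
      using Suc.prems u v by (simp add: \<Delta>_pow_minus)
    then have "(\<Delta> ^^ k) (x \<ominus> u) = \<zero>"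
      using v(1) Wp(1) by (auto simp: minus_eq r_neg)
    then have "x \<ominus> u \<in> W"
      using Suc u by simp
    then have "(x \<ominus> u) \<oplus> u \<in> W"
      using u Wp(4) by blast
    then show ?case
      using Suc.prems(2) u by (simp add: minus_eq a_assoc l_neg)
  qed
  then show ?thesis
    using nilp by blast
qed

end

section \<open>Artin--Schreier extensions\<close>

text \<open>Everything is placed inside one field \<open>L\<close>, with \<open>a\<close> and
  \<open>b\<close> standing for \<alpha> and \<beta>. Irreducibility of the polynomial is reflected
  in \<open>L\<close> being a field.\<close>

locale artin_schreier = field L for L (structure) +
  fixes K F :: "'a set" and p n :: nat and a b :: 'a
  assumes prime_p: "Factorial_Ring.prime p"
    and subfield_K: "subfield K L" and subfield_F: "subfield F L" and K_le_F: "K \<subseteq> F"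
    and card_K: "card K = p"
    and dim_F: "dimension n K F" and dim_L: "dimension p F (carrier L)"
    and Span_b: "Span F (exp_base b p) = carrier L"
    and a_in: "a \<in> F" and b_in: "b \<in> carrier L" and b_pow_p: "b [^] p = b \<oplus> a"
begin

lemma F_carrier: "x \<in> F \<Longrightarrow> x \<in> carrier L"
  using subfieldE(3)[OF subfield_F] by blast

lemmas F_subring = subringE[OF subfieldE(1)[OF subfield_F]]

section \<open>Cardinalities and fixed fields of Frobenius powers\<close>

lemma finite_K: "finite K"
  using card_K prime_p by (metis card.infinite not_prime_0)

lemma card_F: "finite F" "card F = p ^ n"
  using card_dimension[OF subfield_K finite_K dim_F] card_K by auto

lemma dim_L_K: "dimension (n * p) K (carrier L)"
  using telescopic_base[OF subfield_K subfield_F dim_F dim_L] .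

lemma card_L: "finite (carrier L)" "card (carrier L) = p ^ (n * p)"
  using card_dimension[OF subfield_K finite_K dim_L_K] card_K by auto

lemma char_p: "[p] \<cdot> \<one> = \<zero>"
  using char_card_subfield[OF subfield_K] card_K by simp

lemmas frob = frobenius_hom[OF prime_p char_p]
lemmas frob_add = ring_hom_add[OF frob]

lemma frob_F_iff: "x \<in> carrier L \<Longrightarrow> x [^] (p ^ n) = x \<longleftrightarrow> x \<in> F"
  using pow_card_subfield_iff[OF subfield_F card_L(1)] card_F by simp

lemma frob_K_iff: "x \<in> carrier L \<Longrightarrow> x [^] p = x \<longleftrightarrow> x \<in> K"
  using pow_card_subfield_iff[OF subfield_K card_L(1)] card_K by simp

lemma frob_L: "x \<in> carrier L \<Longrightarrow> x [^] (p ^ (n * p)) = x"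
  using pow_card_subfield_iff[OF carrier_is_subfield card_L(1)] card_L by simp

lemma frob_minus:
  assumes "x \<in> carrier L" "y \<in> carrier L"
  shows "(x \<ominus> y) [^] (p ^ m) = x [^] (p ^ m) \<ominus> y [^] (p ^ m)"
proof -
  have "x [^] (p ^ m) = ((x \<ominus> y) \<oplus> y) [^] (p ^ m)"
    using assms by (simp add: minus_eq a_assoc l_neg)
  also have "\<dots> = (x \<ominus> y) [^] (p ^ m) \<oplus> y [^] (p ^ m)"
    using assms by (intro frob_add) auto
  finally show ?thesis
    using assms by (simp add: minus_eq a_assoc r_neg)
qed

lemma frob_comm: "x \<in> carrier L \<Longrightarrow> (x [^] (i :: nat)) [^] (j :: nat) = (x [^] j) [^] i"
  by (simp add: nat_pow_pow mult.commute)

text \<open>Iterating \<open>b_pow_p\<close> identifies this as a + a^p + ... + a^(p^(n-1)), the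
  trace of \<open>a\<close> from \<open>F\<close> to \<open>K\<close>.\<close>

definition \<tau> :: 'a where "\<tau> = b [^] (p ^ n) \<ominus> b"

lemma b_frob: "b [^] (p ^ n) = b \<oplus> \<tau>"
  using b_in nat_pow_closed[OF b_in, of "p ^ n"] unfolding \<tau>_def by algebra

text \<open>All iterated \<open>p\<close>-th powers of \<open>b\<close> stay in the coset of
  \<open>b\<close> modulo \<open>F\<close>: the offset \<open>t\<close> is replaced by
  \<open>a \<oplus> t [^] p\<close>.\<close>

lemma \<tau>_in_F: "\<tau> \<in> F"
proof -
  have "\<exists>t\<in>F. b [^] (p ^ m) = b \<oplus> t" for m
  proof (induction m)
    case 0
    then show ?case using b_in F_subring(2) by (intro bexI[of _ "\<zero>"]) (auto simp del: One_nat_def)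
  next
    case (Suc m)
    then obtain t where t: "t \<in> F" "b [^] (p ^ m) = b \<oplus> t" by blast
    have "b [^] (p ^ Suc m) = (b [^] (p ^ m)) [^] p"
      using b_in by (simp add: nat_pow_pow mult.commute)
    also have "\<dots> = b \<oplus> (a \<oplus> t [^] p)"
      unfolding t(2) using frob_add[of b t 1] b_in t(1) a_in F_carrier
      by (simp add: b_pow_p a_assoc)
    moreover have "a \<oplus> t [^] p \<in> F"
      using subring_nat_pow_closed[OF subfieldE(1)[OF subfield_F] t(1)] a_in F_subring by blast
    ultimately show ?case by auto
  qed
  then obtain t where t: "t \<in> F" "b [^] (p ^ n) = b \<oplus> t" by blast
  then have "\<tau> = t"
    using b_in F_carrier[OF t(1)] unfolding \<tau>_def t(2) by algebra
  then show ?thesis using t by simp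
qed

text \<open>The \<open>p\<close>-th and \<open>p ^ n\<close>-th powers of \<open>b\<close> commute
  and the latter map fixes \<open>a\<close>; comparing both orders gives
  \<open>\<tau> [^] p = \<tau>\<close>.\<close>

lemma \<tau>_in_K: "\<tau> \<in> K"
proof -
  note c = b_in F_carrier[OF a_in] F_carrier[OF \<tau>_in_F]
  have "b \<oplus> (a \<oplus> \<tau> [^] p) = (b \<oplus> \<tau>) [^] p"
    using frob_add[of b \<tau> 1] c by (simp add: b_pow_p a_assoc)
  also have "\<dots> = (b [^] p) [^] (p ^ n)"
    using frob_comm[OF b_in, of p "p ^ n"] b_frob by simp
  also have "\<dots> = b \<oplus> (a \<oplus> \<tau>)"
    using frob_add[of b a n] frob_F_iff[of a] a_in c by (simp add: b_pow_p b_frob a_ac)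
  finally have "\<tau> [^] p = \<tau>"
    using c by simp
  then show ?thesis
    using frob_K_iff c by simp
qed

sublocale unipotent_shift L F "\<lambda>x. x [^] (p ^ n)" b \<tau>
  by (rule unipotent_shift.intro[OF field_axioms], rule unipotent_shift_axioms.intro[OF subfield_F frob
      frob_F_iff b_in b_frob \<tau>_in_F])

text \<open>If \<open>\<tau>\<close> vanished, then \<open>b\<close> would be fixed by \<open>x \<mapsto> x ^ (p ^ n)\<close>, hence lie in \<open>F\<close>.\<close>

lemma \<tau>_nonzero: "\<tau> \<noteq> \<zero>"
proof
  assume "\<tau> = \<zero>"
  then have "b \<in> F"
    using b_frob b_in frob_F_iff by simp
  then have "k \<otimes> u \<in> F" if "k \<in> F" "u \<in> set (exp_base b p)" for k u
    using that F_subring(6) subring_nat_pow_closed[OF subfieldE(1)[OF subfield_F]]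
    by (auto simp: exp_base_def)
  then have "carrier L \<subseteq> F"
    using Span_subsetI[OF subfield_F exp_base_closed[OF b_in], of F]
      subring.axioms(1)[OF subfieldE(1)[OF subfield_F]] Span_b by blast
  then have "F = carrier L"
    using F_carrier by blast
  \<comment> \<open>A field has dimension 1 over itself, but \<open>L\<close> has dimension
    \<open>p\<close> over \<open>F\<close>.\<close>
  then have "p = 1"
    using dimension_is_inj[OF subfield_F dim_L] dimension_one[OF subfield_F] by simp
  then show False using prime_p by simp
qed

text \<open>Power maps commute with each other, and Frobenius powers respect differences.\<close>

lemma \<Delta>_pow_frob:
  assumes "x \<in> carrier L"
  shows "(\<Delta> ^^ k) (x [^] (p ^ m)) = ((\<Delta> ^^ k) x) [^] (p ^ m)"
proof (induction k)
  case (Suc k)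
  have "\<Delta> (y [^] (p ^ m)) = (\<Delta> y) [^] (p ^ m)" if "y \<in> carrier L" for y
    using that frob_minus[of "y [^] (p ^ n)" y m] frob_comm[of y "p ^ m" "p ^ n"]
    unfolding \<Delta>_def by simp
  then show ?case using Suc assms by simp
qed simp

text \<open>
  The case \<open>k = F\<close>, \<open>q = p ^ n\<close>, \<open>e = 1\<close> is the first basis of the theorem, and \<open>k = K\<close>, \<open>q = p\<close> the second.
\<close>

lemma frob_orbit_is_basis:
  fixes q r s m :: nat
  assumes k: "subfield k L" "K \<subseteq> k" "k \<subseteq> F" "dimension m k (carrier L)"
    and q: "q = p ^ r" "q ^ s = p ^ n" "q ^ m = p ^ (n * p)" "\<And>x. x \<in> k \<Longrightarrow> x [^] q = x"
    and e: "e \<in> F" "F \<subseteq> Span k (map (\<lambda>j. e [^] (q ^ j)) [0..<m])"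
    and c: "c \<in> F"
  shows "is_basis_over L k (map (\<lambda>l. (e \<otimes> (b [^] (p - 1) \<ominus> c)) [^] (q ^ l)) [0..<m])"
proof -
  define w where "w = e \<otimes> (b [^] (p - 1) \<ominus> c)"
  define Us where "Us = map (\<lambda>l. w [^] (q ^ l)) [0..<m]"
  define W where "W = Span k Us"
  \<comment> \<open>The value of \<open>\<Delta> ^^ (p - 1)\<close> at \<open>b [^] (p - 1)\<close>.
    As a nonzero element of \<open>k\<close> it can be divided out by a scalar.\<close>
  define d where "d = [(fact (p - 1) :: nat)] \<cdot> (\<tau> [^] (p - 1))"
  note kp = subringE[OF subfieldE(1)[OF k(1)]]
  have p: "p = Suc (p - 1)" "p - 1 \<noteq> 0"
    using prime_gt_1_nat[OF prime_p] by auto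
  have w: "w \<in> carrier L"
    using e c b_in F_carrier by (simp add: w_def)
  then have Us: "set Us \<subseteq> carrier L"
    by (auto simp: Us_def)
  have W: "subgroup W (add_monoid L)"
    unfolding W_def by (rule Span_is_add_subgroup[OF k(1) Us])
  note Wp = add.subgroupE[OF W]
  have W_smult: "x \<otimes> v \<in> W" if "x \<in> k" "v \<in> W" for x v
    using that Span_smult_closed[OF k(1) Us] by (simp add: W_def)
  have Us_W: "set Us \<subseteq> W"
    unfolding W_def by (rule Span_base_incl[OF k(1) Us])
  have frob_q: "(x \<oplus> y) [^] q = x [^] q \<oplus> y [^] q" if "x \<in> carrier L" "y \<in> carrier L" for x y
    using that frob_add q(1) by simp

  have d: "d \<in> k" "d \<noteq> \<zero>"
  proof -
    show "d \<in> k"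
      unfolding d_def using \<tau>_in_K k(2) subfieldE(1)[OF k(1)]
      by (intro subring_add_pow_closed subring_nat_pow_closed) auto
    \<comment> \<open>All factors of this factorial lie strictly between 0 and
      \<open>p\<close>.\<close>
    have "[(fact j :: nat)] \<cdot> \<one> \<noteq> \<zero>" if "j \<le> p - 1" for j :: nat
      using that
    proof (induction j)
      case (Suc j)
      have "[(fact (Suc j) :: nat)] \<cdot> \<one> = [(Suc j)] \<cdot> \<one> \<otimes> [(fact j :: nat)] \<cdot> \<one>"
        by (simp add: add_pow_ldistr add.nat_pow_pow mult.commute del: add.nat_pow_Suc)
      moreover have "[(Suc j)] \<cdot> \<one> \<noteq> \<zero>"
        using Suc.prems p by (intro add_pow_neq_zero[OF prime_p char_p]) auto
      ultimately show ?case
        using Suc integral_iff by simp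
    qed (simp del: One_nat_def)
    then have "[(fact (p - 1) :: nat)] \<cdot> \<one> \<noteq> \<zero>"
      by blast
    moreover have "\<tau> [^] j \<noteq> \<zero>" for j :: nat
      using \<tau>_nonzero F_carrier[OF \<tau>_in_F] by (induction j) (auto simp: integral_iff)
    moreover have "d = ([(fact (p - 1) :: nat)] \<cdot> \<one>) \<otimes> \<tau> [^] (p - 1)"
      using F_carrier[OF \<tau>_in_F] by (simp add: d_def add_pow_ldistr)
    ultimately show "d \<noteq> \<zero>"
      using F_carrier[OF \<tau>_in_F] by (simp add: integral_iff)
  qed
  have d_c: "d \<in> carrier L" using d k F_carrier by blast
  have inv_d: "inv d \<in> k" "inv d \<otimes> d = \<one>"
    using subfield_m_inv[OF k(1), of d] d by auto

  \<comment> \<open>Since \<open>p - 1\<close> is positive, the constant \<open>c\<close> is killed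
    and leaves no trace in \<open>\<Delta>w\<close>.\<close>
  have "(\<Delta> ^^ Suc j) c = \<zero>" for j
    using \<Delta>_eq_zero_iff[of c] c F_carrier by (simp add: funpow_Suc_right del: funpow.simps)
  then have "(\<Delta> ^^ (p - 1)) c = \<zero>"
    using p(2) by (metis not0_implies_Suc)
  moreover have "(\<Delta> ^^ (p - 1)) (b [^] (p - 1)) = d"
    unfolding d_def by (rule \<Delta>_pow_b_pow)
  ultimately have "(\<Delta> ^^ (p - 1)) (b [^] (p - 1) \<ominus> c) = d"
    using c b_in F_carrier d_c by (subst \<Delta>_pow_minus) (auto simp: minus_eq)
  then have \<Delta>w: "(\<Delta> ^^ (p - 1)) w = e \<otimes> d"
    unfolding w_def using e(1) c b_in F_carrier by (subst \<Delta>_pow_smult) auto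
  have \<Delta>orbit: "(\<Delta> ^^ (p - 1)) (w [^] (q ^ j)) = e [^] (q ^ j) \<otimes> d" for j
  proof -
    have "(\<Delta> ^^ (p - 1)) (w [^] (q ^ j)) = (e \<otimes> d) [^] (q ^ j)"
      unfolding \<Delta>w[symmetric] using \<Delta>_pow_frob[OF w, of "p - 1" "r * j"] q(1)
      by (simp add: power_mult)
    also have "\<dots> = e [^] (q ^ j) \<otimes> d [^] (q ^ j)"
      using e F_carrier d_c by (simp add: nat_pow_distrib)
    \<comment> \<open>Elements of \<open>k\<close> are fixed by the \<open>q\<close>-th power
      map.\<close>
    also have "d [^] (q ^ j) = d"
      using nat_pow_iterate_fixed[OF d_c] q(4) d(1) by simp
    finally show ?thesis .
  qed

  \<comment> \<open>The \<open>q\<close>-th power map is additive and fixes \<open>k\<close>, so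
    only the generators matter, and these it shifts cyclically.\<close>
  have W_frob: "x [^] q \<in> W" if "x \<in> W" for x
  proof -
    let ?E = "{x \<in> carrier L. x [^] q \<in> W}"
    have neg: "(\<ominus> x) [^] q = \<ominus> (x [^] q)" if "x \<in> carrier L" for x
      using that frob_minus[of \<zero> x r] prime_p by (simp add: q(1) minus_eq nat_pow_zero)
    have "subgroup ?E (add_monoid L)"
      using Wp(3,4) frob_q neg subgroup.one_closed[OF W] prime_p q(1)
      by (intro add.subgroupI) (auto simp: nat_pow_zero intro!: exI[of _ \<zero>])
    moreover have "x \<otimes> u \<in> ?E" if xk: "x \<in> k" and us: "u \<in> set Us" for x u
    proof -
      have x: "x \<in> carrier L" using xk kp(1) by blast
      obtain l where l: "l < m" "u = w [^] (q ^ l)"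
        using us by (auto simp: Us_def)
      have u: "u [^] q = w [^] (q ^ Suc l)"
        using w by (simp add: l nat_pow_pow mult.commute)
      have "u [^] q \<in> W"
      proof (cases "Suc l < m")
        case True
        then have "w [^] (q ^ Suc l) \<in> set Us"
          by (auto simp: Us_def simp del: power_Suc)
        then show ?thesis using Us_W u by auto
      next
        case False
        \<comment> \<open>The last generator returns to \<open>w\<close>, because
          \<open>q ^ m\<close> is the cardinality of \<open>L\<close>.\<close>
        then have "Suc l = m" using l by simp
        then have "u [^] q = w [^] (q ^ 0)"
          using u q(3) frob_L[OF w] w by (simp del: One_nat_def)
        moreover have "w [^] (q ^ 0) \<in> set Us"
          unfolding Us_def set_map using l(1) by (intro image_eqI[where x = 0]) auto
        ultimately show ?thesis using Us_W by auto
      qed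
      then show ?thesis
        using x w l(2) q(4)[OF xk] W_smult[OF xk] by (simp add: nat_pow_distrib)
    qed
    ultimately have "W \<subseteq> ?E"
      unfolding W_def by (intro Span_subsetI[OF k(1) Us])
    then show ?thesis using that by blast
  qed
  have W_frob_pow: "x [^] (q ^ j) \<in> W" if "x \<in> W" for x j
    using that
  proof (induction j)
    case (Suc j)
    have "x [^] (q ^ Suc j) = (x [^] (q ^ j)) [^] q"
      using Suc.prems Wp(1) by (subst nat_pow_pow) (auto simp: mult.commute)
    then show ?case using Suc W_frob by simp
  qed (use Wp(1) in \<open>auto simp del: One_nat_def\<close>)

  \<comment> \<open>By \<open>\<Delta>orbit\<close> the image contains all
    \<open>k\<close>-multiples of the powers \<open>e [^] (q ^ j)\<close>, whose span contains
    \<open>F\<close>.\<close>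
  have "F \<subseteq> (\<Delta> ^^ (p - 1)) ` W"
  proof -
    let ?E = "(\<Delta> ^^ (p - 1)) ` W"
    have add: "(\<Delta> ^^ (p - 1)) x \<oplus> (\<Delta> ^^ (p - 1)) y \<in> ?E" if "x \<in> W" "y \<in> W" for x y
      using that Wp(4) \<Delta>_pow_add[OF subsetD[OF Wp(1)] subsetD[OF Wp(1)], of x y "p - 1"]
      by (intro image_eqI[of _ _ "x \<oplus> y"]) auto
    have neg: "\<ominus> (\<Delta> ^^ (p - 1)) x \<in> ?E" if "x \<in> W" for x
      using that Wp(3) \<Delta>_pow_minus[OF zero_closed subsetD[OF Wp(1)], of x "p - 1"]
        subsetD[OF Wp(1), of x]
      by (intro image_eqI[of _ _ "\<ominus> x"]) (auto simp: minus_eq)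
    have "subgroup ?E (add_monoid L)"
      using Wp(1,2) add neg by (intro add.subgroupI) auto
    moreover have "x \<otimes> u \<in> ?E" if x: "x \<in> k" and u: "u \<in> set (map (\<lambda>j. e [^] (q ^ j)) [0..<m])" for x u
    proof -
      obtain j where j: "j < m" "u = e [^] (q ^ j)"
        using u by auto
      have c: "x \<in> carrier L" "u \<in> carrier L" "inv d \<in> carrier L"
        using x j e F_carrier kp(1) inv_d by auto
      \<comment> \<open>Dividing by \<open>d\<close> in advance cancels the factor that
        \<open>\<Delta>orbit\<close> introduces.\<close>
      have xd: "x \<otimes> inv d \<in> k"
        using x inv_d(1) kp(6) by blast
      have "w [^] (q ^ j) \<in> W"
        using Us_W j(1) by (auto simp: Us_def)
      then have v: "(x \<otimes> inv d) \<otimes> w [^] (q ^ j) \<in> W"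
        using W_smult[OF xd] by blast
      have "(\<Delta> ^^ (p - 1)) ((x \<otimes> inv d) \<otimes> w [^] (q ^ j)) = (x \<otimes> inv d) \<otimes> (u \<otimes> d)"
        using xd k(3) w \<Delta>orbit[of j] by (subst \<Delta>_pow_smult) (auto simp: j)
      also have "\<dots> = x \<otimes> u \<otimes> (inv d \<otimes> d)"
        using c d_c by (simp add: m_ac)
      finally have "(\<Delta> ^^ (p - 1)) ((x \<otimes> inv d) \<otimes> w [^] (q ^ j)) = x \<otimes> u"
        using c inv_d by simp
      then show ?thesis using v by (metis image_eqI)
    qed
    moreover have "set (map (\<lambda>j. e [^] (q ^ j)) [0..<m]) \<subseteq> carrier L"
      using e(1) F_carrier by auto
    ultimately have "Span k (map (\<lambda>j. e [^] (q ^ j)) [0..<m]) \<subseteq> ?E"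
      using Span_subsetI[OF k(1)] by blast
    then show ?thesis using e(2) by blast
  qed
  moreover have "(\<Delta> ^^ Suc (p - 1)) x = \<zero>" if "x \<in> carrier L" for x
    using \<Delta>_pow_eq_zero_of_Span[of x p] that Span_b p(1) by simp
  \<comment> \<open>The map \<sigma> is the \<open>s\<close>-th iterate of the \<open>q\<close>-th
    power map.\<close>
  moreover have "x [^] (p ^ n) \<in> W" if "x \<in> W" for x
    using W_frob_pow[OF that, of s] q(2) by simp
  ultimately have "carrier L \<subseteq> W"
    using \<sigma>_stable_subgroup_eq_carrier[OF W] by blast
  then have "is_basis_over L k Us"
    using spanning_is_basis_over[OF k(1) Us] k(4) by (simp add: W_def Us_def)
  then show ?thesis
    by (simp add: Us_def w_def)
qed

section \<open>The two bases inside \<open>L\<close>\<close>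

lemma K_fixed: "x \<in> K \<Longrightarrow> x [^] p = x"
  using frob_K_iff[of x] K_le_F F_carrier by blast

lemma F_fixed: "x \<in> F \<Longrightarrow> x [^] (p ^ n) = x"
  using frob_F_iff[of x] F_carrier by blast

lemma basis_over_F:
  assumes "c \<in> F"
  shows "is_basis_over L F (map (\<lambda>i. (b [^] (p - 1) \<ominus> c) [^] (p ^ (i * n))) [0..<p])"
proof -
  \<comment> \<open>Every entry equals the unit, so the span contains \<open>F\<close> as soon as
    the list is nonempty.\<close>
  let ?Us = "map (\<lambda>j. \<one> [^] ((p ^ n) ^ j)) [0..<p]"
  have Us: "set ?Us \<subseteq> carrier L"
    by auto
  have "0 \<in> {0..<p}"
    using prime_gt_0_nat[OF prime_p] by simp
  then have "\<one> \<in> set ?Us"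
    by (force simp: image_iff)
  then have one: "\<one> \<in> Span F ?Us"
    using Span_base_incl[OF subfield_F Us] by blast
  have "F \<subseteq> Span F ?Us"
  proof
    fix x assume "x \<in> F"
    from Span_smult_closed[OF subfield_F Us this one] show "x \<in> Span F ?Us"
      using F_carrier[OF \<open>x \<in> F\<close>] by (simp del: Span.simps)
  qed
  then have "is_basis_over L F
      (map (\<lambda>l. (\<one> \<otimes> (b [^] (p - 1) \<ominus> c)) [^] ((p ^ n) ^ l)) [0..<p])"
    by (intro frob_orbit_is_basis[where r = n and s = 1] subfield_F K_le_F subset_refl dim_L refl
        power_one_right power_mult[symmetric] F_fixed F_subring(3) assms)
  moreover have "\<one> \<otimes> (b [^] (p - 1) \<ominus> c) = b [^] (p - 1) \<ominus> c"
    using b_in F_carrier[OF assms] by simp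
  moreover have "(p ^ n) ^ i = p ^ (i * n)" for i
    by (simp add: mult.commute flip: power_mult)
  ultimately show ?thesis
    by (simp only:)
qed

lemma basis_over_K:
  assumes "c \<in> K" "e \<in> F" "Span K (map (\<lambda>j. e [^] (p ^ j)) [0..<n]) = F"
  shows "is_basis_over L K (map (\<lambda>l. (e \<otimes> (b [^] (p - 1) \<ominus> c)) [^] (p ^ l)) [0..<n * p])"
proof (rule frob_orbit_is_basis[where r = 1 and s = n])
  have powers: "set (map (\<lambda>j. e [^] (p ^ j)) [0..<n * p]) \<subseteq> carrier L"
    using F_carrier[OF assms(2)] by auto
  \<comment> \<open>The first \<open>n\<close> powers of \<open>e\<close> already span
    \<open>F\<close>; the longer list matching the orbit spans at least as much.\<close>
  have "n \<le> n * p"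
    using prime_gt_0_nat[OF prime_p] by simp
  then have "set (map (\<lambda>j. e [^] (p ^ j)) [0..<n]) \<subseteq> set (map (\<lambda>j. e [^] (p ^ j)) [0..<n * p])"
    unfolding set_map set_upt by (intro image_mono) auto
  then show "F \<subseteq> Span K (map (\<lambda>j. e [^] (p ^ j)) [0..<n * p])"
    using mono_Span_sublist[OF subfield_K] assms(3) powers by blast
qed (use assms(1,2) K_le_F in \<open>auto intro: subfield_K dim_L_K K_fixed\<close>)

end

section \<open>Transfer to the quotient ring\<close>

lemma (in ring_hom_ring) nat_pow_hom:
  "x \<in> carrier R \<Longrightarrow> h (x [^] (k :: nat)) = h x [^]\<^bsub>S\<^esub> k"
  by (induction k) auto

theorem theorem2p2:
  fixes F :: "('a, 'm) ring_scheme" and Zp :: "'a set" and p n :: nat and \<alpha> \<epsilon> :: 'a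
  assumes "Factorial_Ring.prime p"
    and "field F"
    and "is_Zp_subfield p Zp F"
    and "n \<ge> 1"
    and "ring.dimension F n Zp (carrier F)"
    and "\<alpha> \<in> carrier F - {\<zero>\<^bsub>F\<^esub>}"
    and "\<epsilon> \<in> carrier F - {\<zero>\<^bsub>F\<^esub>}"
    and "pirreducible\<^bsub>F\<^esub> (carrier F) (AS_poly F p \<alpha>)"
    and "is_basis_over F Zp (map (\<lambda>j. \<epsilon> [^]\<^bsub>F\<^esub> (p ^ j)) [0..<n])"
  shows "(\<forall>c \<in> carrier F.
            is_basis_over (AS_ext F p \<alpha>) (AS_embed F p \<alpha> ` carrier F)
              (map (\<lambda>i. (AS_root F p \<alpha> [^]\<^bsub>AS_ext F p \<alpha>\<^esub> (p - 1)
                            \<ominus>\<^bsub>AS_ext F p \<alpha>\<^esub> AS_embed F p \<alpha> c)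
                         [^]\<^bsub>AS_ext F p \<alpha>\<^esub> (p ^ (i * n))) [0..<p])) \<and>
         (\<forall>c \<in> Zp.
            is_basis_over (AS_ext F p \<alpha>) (AS_embed F p \<alpha> ` Zp)
              (map (\<lambda>l. (AS_embed F p \<alpha> \<epsilon> \<otimes>\<^bsub>AS_ext F p \<alpha>\<^esub>
                           (AS_root F p \<alpha> [^]\<^bsub>AS_ext F p \<alpha>\<^esub> (p - 1)
                              \<ominus>\<^bsub>AS_ext F p \<alpha>\<^esub> AS_embed F p \<alpha> c))
                         [^]\<^bsub>AS_ext F p \<alpha>\<^esub> (p ^ l)) [0..<n * p]))"
proof -
  interpret F: field F by fact
  interpret P: domain "poly_ring F"
    using F.univ_poly_is_domain[OF F.carrier_is_subring] .
  let ?f = "AS_poly F p \<alpha>" and ?L = "AS_ext F p \<alpha>"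
  let ?s = "F.rupture_surj (carrier F) ?f" and ?e = "AS_embed F p \<alpha>" and ?b = "AS_root F p \<alpha>"
  have \<alpha>: "\<alpha> \<in> carrier F" and \<epsilon>: "\<epsilon> \<in> carrier F"
    using assms(6,7) by auto
  have p: "p \<ge> 2" using prime_ge_2_nat[OF assms(1)] .
  note const_hom = F.canonical_embedding_is_hom[OF F.carrier_is_subring]
  have X: "X\<^bsub>F\<^esub> \<in> carrier (poly_ring F)"
    using F.var_closed(1)[OF F.carrier_is_subring] .
  have const: "F.poly_of_const x \<in> carrier (poly_ring F)" if "x \<in> carrier F" for x
    using ring_hom_closed[OF const_hom] that by simp
  have f: "?f \<in> carrier (poly_ring F)"
    unfolding AS_poly_def using X const[OF \<alpha>] by simp

  \<comment> \<open>The length of a coefficient list is the degree plus one. The terms below the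
    leading one have length at most 2, less than \<open>Suc p\<close>, so they cannot cancel
    it.\<close>
  have deg_f: "degree ?f = p"
  proof -
    let ?V = "{q \<in> carrier (poly_ring F). length q \<le> 2}"
    let ?g = "\<ominus>\<^bsub>poly_ring F\<^esub> X\<^bsub>F\<^esub> \<oplus>\<^bsub>poly_ring F\<^esub> \<ominus>\<^bsub>poly_ring F\<^esub> F.poly_of_const \<alpha>"
    note V = P.space_subgroup_props[OF F.univ_poly_subfield_of_consts[OF F.carrier_is_subfield]
        F.bounded_degree_dimension[OF F.carrier_is_subfield]]
    have "X\<^bsub>F\<^esub> \<in> ?V" "F.poly_of_const \<alpha> \<in> ?V"
      using X const[OF \<alpha>] by (auto simp: var_def F.poly_of_const_def)
    then have g: "?g \<in> ?V"
      by (intro V(3,4))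
    have m: "X\<^bsub>F\<^esub> [^]\<^bsub>poly_ring F\<^esub> p = F.monom \<one>\<^bsub>F\<^esub> p"
      using F.unitary_monom_eq_var_pow[OF F.carrier_is_subring] by simp
    have "?f = F.monom \<one>\<^bsub>F\<^esub> p \<oplus>\<^bsub>poly_ring F\<^esub> ?g"
      unfolding AS_poly_def m[symmetric] using X const[OF \<alpha>] by (simp add: a_minus_def P.a_assoc)
    moreover have "length ?g < length (F.monom \<one>\<^bsub>F\<^esub> p)"
      using g p by (simp add: F.monom_def)
    moreover from this have "length (F.poly_add (F.monom \<one>\<^bsub>F\<^esub> p) ?g)
        = max (length (F.monom \<one>\<^bsub>F\<^esub> p)) (length ?g)"
      using g F.monom_is_polynomial[OF F.carrier_is_subring, of "\<one>\<^bsub>F\<^esub>" p]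
      by (intro F.poly_add_length_eq[OF F.carrier_is_subring]) (auto simp: univ_poly_carrier)
    ultimately have "length ?f = Suc p"
      by (simp add: univ_poly_add F.monom_def del: F.poly_add.simps)
    then show ?thesis by simp
  qed

  \<comment> \<open>This is where irreducibility enters.\<close>
  interpret L: field ?L
    unfolding AS_ext_def
    using F.rupture_is_field_iff_pirreducible[OF F.carrier_is_subfield f] assms(8) by simp
  interpret S: ring_hom_ring "poly_ring F" ?L ?s
    unfolding AS_ext_def using F.rupture_surj_hom(2)[OF F.carrier_is_subring f] .
  have e: "ring_hom_ring F ?L ?e"
  proof -
    have "?e = ?s \<circ> F.poly_of_const"
      by (auto simp: AS_embed_def)
    then have "?e \<in> ring_hom (F\<lparr>carrier := carrier F\<rparr>) ?L"
      unfolding AS_ext_def using F.rupture_surj_norm_is_hom[OF F.carrier_is_subring f] by simp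
    then show ?thesis
      by (intro ring_hom_ringI2 F.ring_axioms L.ring_axioms) simp
  qed
  interpret E: ring_hom_ring F ?L ?e by (rule e)
  have Zp: "subfield Zp F" using assms(3) by (simp add: is_Zp_subfield_def)
  have inj: "inj_on ?e (carrier F)"
    using E.img_is_subfield(1)[OF F.carrier_is_subfield] L.one_not_zero by simp
  have b: "?b \<in> carrier ?L"
    unfolding AS_root_def using X by simp

  interpret artin_schreier ?L "?e ` Zp" "?e ` carrier F" p n "?e \<alpha>" ?b
  proof (intro artin_schreier.intro artin_schreier_axioms.intro)
    show "field ?L" by (rule L.field_axioms)
    show "Factorial_Ring.prime p" by fact
    show "subfield (?e ` Zp) ?L" "subfield (?e ` carrier F) ?L"
      using E.img_is_subfield(2) Zp F.carrier_is_subfield L.one_not_zero by auto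
    show "?e ` Zp \<subseteq> ?e ` carrier F"
      using subfieldE(3)[OF Zp] by blast
    show "card (?e ` Zp) = p"
    proof -
      obtain h where "h \<in> ring_iso (residue_ring (int p)) (F\<lparr>carrier := Zp\<rparr>)"
        using assms(3) by (auto simp: is_Zp_subfield_def is_ring_iso_def)
      then have "bij_betw h {0..int p - 1} Zp"
        by (simp add: ring_iso_def residue_ring_def)
      then have "card Zp = p"
        using bij_betw_same_card by fastforce
      then show ?thesis
        using card_image[OF inj_on_subset[OF inj subfieldE(3)[OF Zp]]] by simp
    qed
    show "L.dimension n (?e ` Zp) (?e ` carrier F)"
      using E.inj_hom_dimension[OF Zp] L.one_not_zero inj assms(5) by simp
    show "L.dimension p (?e ` carrier F) (carrier ?L)"
      using F.rupture_dimension[OF F.carrier_is_subfield f] deg_f p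
      unfolding AS_ext_def AS_embed_def image_image by simp
    show "?e \<alpha> \<in> ?e ` carrier F" using \<alpha> by blast
    show "?b \<in> carrier ?L" by fact
    show "?b [^]\<^bsub>?L\<^esub> p = ?b \<oplus>\<^bsub>?L\<^esub> ?e \<alpha>"
    proof -
      \<comment> \<open>A polynomial lies in the ideal it generates, so its coset is the zero
        coset.\<close>
      have "?s ?f = \<zero>\<^bsub>?L\<^esub>"
        using P.a_rcos_zero[OF P.cgenideal_ideal[OF f] P.cgenideal_self[OF f]]
        unfolding AS_ext_def rupture_def FactRing_def by simp
      \<comment> \<open>The polynomial also occurs inside the quotient map \<open>?s\<close>; only
        the argument is unfolded.\<close>
      moreover have "?s ?f = ?b [^]\<^bsub>?L\<^esub> p \<ominus>\<^bsub>?L\<^esub> ?b \<ominus>\<^bsub>?L\<^esub> ?e \<alpha>"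
        unfolding AS_root_def AS_embed_def using X const[OF \<alpha>]
        by (subst (2) AS_poly_def) (simp add: a_minus_def S.nat_pow_hom)
      ultimately have "?b [^]\<^bsub>?L\<^esub> p \<ominus>\<^bsub>?L\<^esub> (?b \<oplus>\<^bsub>?L\<^esub> ?e \<alpha>) = \<zero>\<^bsub>?L\<^esub>"
        using b E.hom_closed[OF \<alpha>] by (simp add: L.minus_eq L.minus_add L.a_assoc)
      then show ?thesis
        using b E.hom_closed[OF \<alpha>] by simp
    qed
    show "L.Span (?e ` carrier F) (L.exp_base ?b p) = carrier ?L"
    proof -
      \<comment> \<open>Division with remainder represents each class by a polynomial of length at
        most \<open>p\<close>, a combination of the powers of X below \<open>p\<close>.\<close>
      have "?f \<noteq> []"
        using deg_f p by auto
      then have "carrier ?L = ?s ` {q \<in> carrier (poly_ring F). length q \<le> p}"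
        using F.rupture_carrier_as_pmod_image[OF F.carrier_is_subfield f]
          F.pmod_image_characterization[OF F.carrier_is_subfield f] deg_f
        by (simp add: AS_ext_def)
      also have "\<dots> = ?s ` P.Span (F.poly_of_const ` carrier F) (P.exp_base X\<^bsub>F\<^esub> p)"
        using F.Span_var_pow_base[OF F.carrier_is_subfield, of p] by simp
      also have "\<dots> = L.Span (?s ` F.poly_of_const ` carrier F) (map ?s (P.exp_base X\<^bsub>F\<^esub> p))"
        using const by (intro S.Span_hom[symmetric] P.exp_base_closed X) auto
      also have "map ?s (P.exp_base X\<^bsub>F\<^esub> p) = L.exp_base ?b p"
        using X by (simp add: P.exp_base_def L.exp_base_def AS_root_def S.nat_pow_hom)
      finally show ?thesis
        by (simp add: AS_embed_def image_image)
    qed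
  qed

  \<comment> \<open>The embedding carries the span of the powers of \<epsilon> in \<open>F\<close>
    to the span of their images.\<close>
  have "L.Span (?e ` Zp) (map (\<lambda>j. ?e \<epsilon> [^]\<^bsub>?L\<^esub> (p ^ j)) [0..<n]) = ?e ` carrier F"
  proof -
    let ?Us = "map (\<lambda>j. \<epsilon> [^]\<^bsub>F\<^esub> (p ^ j)) [0..<n]"
    have "L.Span (?e ` Zp) (map ?e ?Us) = ?e ` F.Span Zp ?Us"
      using subfieldE(3)[OF Zp] \<epsilon> by (intro E.Span_hom) auto
    moreover have "F.Span Zp ?Us = carrier F"
      using assms(9) by (simp add: is_basis_over_def)
    moreover have "map ?e ?Us = map (\<lambda>j. ?e \<epsilon> [^]\<^bsub>?L\<^esub> (p ^ j)) [0..<n]"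
      using \<epsilon> by (simp add: E.nat_pow_hom)
    ultimately show ?thesis by (simp only:)
  qed
  note over_Zp = basis_over_K[OF imageI imageI[OF \<epsilon>] this]
  show ?thesis
    by (rule conjI; rule ballI; rule basis_over_F[OF imageI] over_Zp; assumption)
qed

end
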